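(* Let $\mathbb{F}$ be a field, let $d_1,\dots,d_n$ be nonnegative integers, and let $F\in\mathbb{F}[x_1,\dots,x_n]$ be a polynomial such that no monomial majorizes $M=\prod_{i=1}^n x_i^{d_i}$ in $F$. Let $C_1,\dots,C_n$ be finite multisets in $\mathbb{F}$ with multiplicity functions $\omega_1,\dots,\omega_n$ such that $|C_i|=d_i+1$ for every $i$. Assume that either $\mathrm{char}(\mathbb{F})=0$ or $\mathrm{char}(\mathbb{F})\ge\omega_i(c)$ for every index $i$ and every $c\in\mathbb{F}$. Then the coefficient $[M]F$ of $M$ in $F$ equals \[ \sum_{c_1\in C_1}\sum_{m_1<\omega_1(c_1)}\cdots\sum_{c_n\in C_n}\sum_{m_n<\omega_n(c_n)}\prod_{i=1}^n\kappa(C_i,c_i,m_i)\,\frac{\partial^{m_1+\dots+m_n}F}{\partial x_1^{m_1}\cdots\partial x_n^{m_n}}(c_1,\dots,c_n), \] where the $m_i$ range over nonnegative integers and \[ \kappa(C_i,c_i,m_i)=\frac{1}{m_i!\,(\omega_i(c_i)-1-m_i)!}\cdot\left.\left(\frac{1}{\prod_{c\in C_i\setminus\{c_i\}}(x-c)^{\omega_i(c)}}\right)^{(\omega_i(c_i)-1-m_i)}\right|_{x=c_i}. \] Consequently, if $[M]F\ne0$, then there exist $c_i\in C_i$ and integers $0\le m_i<\omega_i(c_i)$ ($1\le i\le n$) such that $\frac{\partial^{m_1+\dots+m_n}F}{\partial x_1^{m_1}\cdots\partial x_n^{m_n}}(c_1,\dots,c_n)\ne0$.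
   Context: A finite multiset $C$ in $\mathbb{F}$ is given by a multiplicity function $\omega:\mathbb{F}\to\{0,1,2,\dots\}$ with finite sum $|C|=\sum_{x\in\mathbb{F}}\omega(x)$; we write $c\in C$ if $\omega(c)\ne0$, and the product over $c\in C_i\setminus\{c_i\}$ ranges over elements $c\ne c_i$ with $\omega_i(c)\neq 0$. The superscript $(j)$ denotes the $j$-th derivative with respect to $x$ (a rational function with no pole at $c_i$). We say that no monomial majorizes $\prod x_i^{d_i}$ in $F$ if every monomial $\prod x_i^{k_i}$ with non-zero coefficient in $F$ satisfies either $k_i=d_i$ for every $i$, or $k_i<d_i$ for some $i$. *)

theory Defs
  imports
    "HOL-Library.Poly_Mapping"
    "HOL-Library.Multiset"
    "HOL-Library.FuncSet"
    "HOL-Computational_Algebra.Polynomial"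
    "HOL-Computational_Algebra.Fraction_Field"
begin

text \<open>
  Following the remarks in HOL-Library.Poly_Mapping, a multivariate polynomial maps exponent
  vectors (finitely supported functions from variable indices to exponents) to coefficients.
\<close>

type_synonym 'a mpolynomial = "(nat \<Rightarrow>\<^sub>0 nat) \<Rightarrow>\<^sub>0 'a"

definition mpolynomials_in :: "nat set \<Rightarrow> 'a::zero mpolynomial set" where
  "mpolynomials_in V = {F. \<forall>k\<in>Poly_Mapping.keys F. Poly_Mapping.keys k \<subseteq> V}"

definition exponent_vector :: "nat \<Rightarrow> (nat \<Rightarrow> nat) \<Rightarrow> (nat \<Rightarrow>\<^sub>0 nat)" where
  "exponent_vector n d = (\<Sum>i\<in>{1..n}. Poly_Mapping.single i (d i))"

definition no_monomial_majorizes :: "nat \<Rightarrow> (nat \<Rightarrow> nat) \<Rightarrow> 'a::zero mpolynomial \<Rightarrow> bool" where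
  "no_monomial_majorizes n d F \<longleftrightarrow>
     (\<forall>k\<in>Poly_Mapping.keys F.
        (\<forall>i\<in>{1..n}. Poly_Mapping.lookup k i = d i) \<or>
        (\<exists>i\<in>{1..n}. Poly_Mapping.lookup k i < d i))"

definition mpoly_eval :: "(nat \<Rightarrow> 'a) \<Rightarrow> 'a::comm_semiring_1 mpolynomial \<Rightarrow> 'a" where
  "mpoly_eval x F =
     (\<Sum>k\<in>Poly_Mapping.keys F. Poly_Mapping.lookup F k *
        (\<Prod>i\<in>Poly_Mapping.keys k. x i ^ Poly_Mapping.lookup k i))"

text \<open>
  Where the subtraction of exponents truncates, the coefficient is 0.
\<close>

definition mpoly_pderiv :: "nat \<Rightarrow> 'a::comm_semiring_1 mpolynomial \<Rightarrow> 'a mpolynomial" where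
  "mpoly_pderiv i F =
     (\<Sum>k\<in>Poly_Mapping.keys F.
        Poly_Mapping.single (k - Poly_Mapping.single i 1)
          (of_nat (Poly_Mapping.lookup k i) * Poly_Mapping.lookup F k))"

definition mixed_pderiv ::
  "nat \<Rightarrow> (nat \<Rightarrow> nat) \<Rightarrow> 'a::comm_semiring_1 mpolynomial \<Rightarrow> 'a mpolynomial" where
  "mixed_pderiv n m F = foldr (\<lambda>i. mpoly_pderiv i ^^ m i) [1..<Suc n] F"

text \<open>
  The field of rational functions in one variable is the fraction field of the polynomial ring;
  its derivation is given by the quotient rule.
\<close>

lift_definition ratfun_deriv :: "'a::field poly fract \<Rightarrow> 'a poly fract"
  is "\<lambda>(p, q). (pderiv p * q - p * pderiv q, q\<^sup>2)"
proof -
  fix x y :: "'a poly \<times> 'a poly"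
  assume xy: "fractrel x y"
  obtain p q where x: "x = (p, q)" by (cases x)
  obtain r s where y: "y = (r, s)" by (cases y)
  from xy have nz: "q \<noteq> 0" "s \<noteq> 0" and eq: "p * s = r * q"
    by (simp_all add: x y)
  from eq have "pderiv (p * s) = pderiv (r * q)" by simp
  then have d: "p * pderiv s + s * pderiv p = r * pderiv q + q * pderiv r"
    by (simp add: pderiv_mult)
  have "(pderiv p * q - p * pderiv q) * s\<^sup>2 = (pderiv r * s - r * pderiv s) * q\<^sup>2"
    using eq d by algebra
  with nz show "fractrel (case x of (p, q) \<Rightarrow> (pderiv p * q - p * pderiv q, q\<^sup>2))
                 (case y of (p, q) \<Rightarrow> (pderiv p * q - p * pderiv q, q\<^sup>2))"
    by (simp add: x y)
qed

lemma ratfun_deriv_Fract: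
  "q \<noteq> 0 \<Longrightarrow> ratfun_deriv (Fract p q) = Fract (pderiv p * q - p * pderiv q) (q\<^sup>2)"
  by transfer simp

text \<open>
  The value is only meaningful if the rational function has no pole at the given point, that is,
  if it is represented by some fraction whose denominator does not vanish there.
\<close>

definition ratfun_eval :: "'a::field poly fract \<Rightarrow> 'a \<Rightarrow> 'a" where
  "ratfun_eval f a =
     (THE v. \<exists>p q. f = Fract p q \<and> poly q a \<noteq> 0 \<and> v = poly p a / poly q a)"

lemma ratfun_eval_Fract:
  fixes p q :: "'a::field poly"
  assumes "poly q a \<noteq> 0"
  shows "ratfun_eval (Fract p q) a = poly p a / poly q a"
  unfolding ratfun_eval_def
proof (rule the_equality)
  fix v
  assume "\<exists>r s. Fract p q = Fract r s \<and> poly s a \<noteq> 0 \<and> v = poly r a / poly s a"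
  then obtain r s where rs: "Fract p q = Fract r s" "poly s a \<noteq> 0" "v = poly r a / poly s a"
    by blast
  from assms rs(2) have "q \<noteq> 0" "s \<noteq> 0" by auto
  with rs(1) have "p * s = r * q" by (simp add: eq_fract)
  then have "poly p a * poly s a = poly r a * poly q a" by (metis poly_mult)
  with assms rs(2,3) show "v = poly p a / poly q a" by (simp add: frac_eq_eq)
qed (use assms in blast)

text \<open>
  The factorials are computed in the natural numbers, as the library's generic
  \<^const>\<open>fact\<close> is restricted to characteristic 0.
\<close>

definition kappa :: "'a::field multiset \<Rightarrow> 'a \<Rightarrow> nat \<Rightarrow> 'a" where
  "kappa C a m =
     1 / (of_nat (fact m) * of_nat (fact (count C a - 1 - m))) *
     ratfun_eval
       ((ratfun_deriv ^^ (count C a - 1 - m))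
          (Fract 1 (\<Prod>c\<in>set_mset C - {a}. [:- c, 1:] ^ count C c))) a"

end

theory Submission
  imports Defs
begin

text \<open>
  For one variable the functional \<open>p \<mapsto> \<Sum>a. \<Sum>m. kappa C a m * p\<^sup>(\<^sup>m\<^sup>)(a)\<close> is, by the Leibniz
  rule, the sum of the residues of \<open>p / P\<close>, where \<open>P\<close> is the monic polynomial with root multiset
  \<open>C\<close>. If \<open>degree p \<le> d\<close> and \<open>size C = d + 1\<close>, the partial fraction decomposition of \<open>p / P\<close> shows
  that this sum is the coefficient of \<open>x\<^sup>d\<close> in \<open>p\<close>: it is 0 on lower powers and 1 on \<open>x\<^sup>d\<close>.
  On a monomial in several variables the multiple sum factors into these univariate functionals.
  Every monomial of \<open>F\<close> other than \<open>M\<close> has some exponent below \<open>d i\<close>, so only \<open>M\<close> survives.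
\<close>

section \<open>Derivations and rational functions\<close>

text \<open>Induction with Pascal's rule. Additivity and the product rule already give D 0 = 0 and D
  1 = 0, so D treats the binomial coefficients as constants. The instance
  \<open>ratfun_deriv\<close> will separate \<open>p\<close> from the reciprocal of its
  denominator.\<close>

lemma derivation_higher_mult:
  fixes D :: "'b::comm_ring_1 \<Rightarrow> 'b"
  assumes add: "\<And>f g. D (f + g) = D f + D g"
    and mult: "\<And>f g. D (f * g) = D f * g + f * D g"
  shows "(D ^^ N) (f * g) = (\<Sum>m\<le>N. of_nat (N choose m) * ((D ^^ m) f * (D ^^ (N - m)) g))"
proof (induction N)
  case 0
  show ?case by simp
next
  case (Suc N)
  have D0: "D 0 = 0" using add[of 0 0] by simp
  have D1: "D 1 = 0" using mult[of 1 1] by simp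
  have D_of_nat: "D (of_nat k) = 0" for k
    by (induction k) (simp_all add: D0 D1 add)
  have D_sum: "D (sum h A) = (\<Sum>x\<in>A. D (h x))" for h :: "nat \<Rightarrow> 'b" and A
    by (induction A rule: infinite_finite_induct) (simp_all add: D0 add)
  define u where "u m = (D ^^ m) f" for m
  define v where "v m = (D ^^ m) g" for m
  have Du: "D (u m) = u (Suc m)" and Dv: "D (v m) = v (Suc m)" for m
    by (simp_all add: u_def v_def)
  have "(D ^^ Suc N) (f * g) = (\<Sum>m\<le>N. D (of_nat (N choose m) * (u m * v (N - m))))"
    using Suc.IH by (simp add: D_sum u_def v_def)
  also have "\<dots> = (\<Sum>m\<le>N. of_nat (N choose m) * (u (Suc m) * v (N - m)))
      + (\<Sum>m\<le>N. of_nat (N choose m) * (u m * v (Suc N - m)))"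
    by (simp add: mult D_of_nat Du Dv algebra_simps sum.distrib Suc_diff_le)
  \<comment> \<open>The added term has coefficient \<open>N choose Suc N\<close>, which is 0. After
    it, an index shift puts both sums over the same products, ready for Pascal's rule.\<close>
  also have "(\<Sum>m\<le>N. of_nat (N choose m) * (u m * v (Suc N - m)))
      = (\<Sum>m\<le>Suc N. of_nat (N choose m) * (u m * v (Suc N - m)))"
    by (simp add: binomial_eq_0)
  also have "\<dots> = u 0 * v (Suc N) + (\<Sum>m\<le>N. of_nat (N choose Suc m) * (u (Suc m) * v (N - m)))"
    by (subst sum.atMost_Suc_shift) simp
  also have "(\<Sum>m\<le>N. of_nat (N choose m) * (u (Suc m) * v (N - m))) + \<dots>
      = (\<Sum>m\<le>Suc N. of_nat (Suc N choose m) * (u m * v (Suc N - m)))"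
    by (subst sum.atMost_Suc_shift) (simp add: sum.distrib algebra_simps)
  finally show ?case by (simp only: u_def v_def)
qed

section \<open>The quotient-rule derivation and its iterates\<close>

lemma ratfun_deriv_add: "ratfun_deriv (f + g) = ratfun_deriv f + ratfun_deriv g"
proof -
  obtain p q where f: "f = Fract p q" "q \<noteq> 0" by (cases f)
  obtain r s where g: "g = Fract r s" "s \<noteq> 0" by (cases g)
  show ?thesis
    using f g
    by (simp add: ratfun_deriv_Fract eq_fract pderiv_add pderiv_mult power2_eq_square algebra_simps)
qed

lemma ratfun_deriv_mult: "ratfun_deriv (f * g) = ratfun_deriv f * g + f * ratfun_deriv g"
proof -
  obtain p q where f: "f = Fract p q" "q \<noteq> 0" by (cases f)
  obtain r s where g: "g = Fract r s" "s \<noteq> 0" by (cases g)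
  show ?thesis
    using f g
    by (simp add: ratfun_deriv_Fract eq_fract pderiv_mult power2_eq_square algebra_simps)
qed

lemma ratfun_deriv_funpow_add:
  "(ratfun_deriv ^^ N) (f + g) = (ratfun_deriv ^^ N) f + (ratfun_deriv ^^ N) g"
  by (induction N) (simp_all add: ratfun_deriv_add)

lemma ratfun_deriv_funpow_poly:
  "(ratfun_deriv ^^ N) (Fract p 1) = Fract ((pderiv ^^ N) p) 1"
  by (induction N) (simp_all add: ratfun_deriv_Fract)

text \<open>These functions form the local ring at \<open>a\<close>, which is closed under
  \<open>ratfun_deriv\<close>. \<open>ratfun_eval\<close> is a definite description that is
  meaningless at a pole, so it is shown to be a ring homomorphism on this local ring only.\<close>

definition regular_at :: "'a::field \<Rightarrow> 'a poly fract \<Rightarrow> bool" where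
  "regular_at a f \<longleftrightarrow> (\<exists>p q. f = Fract p q \<and> poly q a \<noteq> 0)"

lemma regular_at_Fract: "poly q a \<noteq> 0 \<Longrightarrow> regular_at a (Fract p q)"
  unfolding regular_at_def by blast

lemma regular_atE:
  assumes "regular_at a f"
  obtains p q where "f = Fract p q" "poly q a \<noteq> 0" "q \<noteq> 0"
  using assms unfolding regular_at_def by force

lemma regular_at_add: "regular_at a f \<Longrightarrow> regular_at a g \<Longrightarrow> regular_at a (f + g)"
  by (elim regular_atE) (simp add: regular_at_Fract)

lemma regular_at_mult: "regular_at a f \<Longrightarrow> regular_at a g \<Longrightarrow> regular_at a (f * g)"
  by (elim regular_atE) (simp add: regular_at_Fract)

lemma regular_at_deriv: "regular_at a f \<Longrightarrow> regular_at a (ratfun_deriv f)"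
  by (elim regular_atE) (simp add: regular_at_Fract ratfun_deriv_Fract)

lemma regular_at_deriv_funpow: "regular_at a f \<Longrightarrow> regular_at a ((ratfun_deriv ^^ N) f)"
  by (induction N) (simp_all add: regular_at_deriv)

lemma regular_at_poly: "regular_at a (Fract p 1)"
  by (simp add: regular_at_Fract)

lemma regular_at_of_nat: "regular_at a (of_nat k)"
  using regular_at_poly[of a "of_nat k"] by (simp add: of_nat_fract)

lemma ratfun_eval_add:
  "regular_at a f \<Longrightarrow> regular_at a g \<Longrightarrow> ratfun_eval (f + g) a = ratfun_eval f a + ratfun_eval g a"
  by (elim regular_atE) (simp add: ratfun_eval_Fract add_frac_eq)

lemma ratfun_eval_mult:
  "regular_at a f \<Longrightarrow> regular_at a g \<Longrightarrow> ratfun_eval (f * g) a = ratfun_eval f a * ratfun_eval g a"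
  by (elim regular_atE) (simp add: ratfun_eval_Fract)

lemma ratfun_eval_poly: "ratfun_eval (Fract p 1) a = poly p a"
  by (simp add: ratfun_eval_Fract)

lemma ratfun_eval_of_nat: "ratfun_eval (of_nat k) a = of_nat k"
  using ratfun_eval_poly[of "of_nat k" a] by (simp add: of_nat_fract)

lemma regular_at_sum:
  "(\<And>x. x \<in> A \<Longrightarrow> regular_at a (f x)) \<Longrightarrow> regular_at a (sum f A)"
  by (induction A rule: infinite_finite_induct)
    (use regular_at_of_nat[of a 0] in \<open>simp_all add: regular_at_add\<close>)

lemma ratfun_eval_sum:
  "(\<And>x. x \<in> A \<Longrightarrow> regular_at a (f x)) \<Longrightarrow> ratfun_eval (sum f A) a = (\<Sum>x\<in>A. ratfun_eval (f x) a)"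
  by (induction A rule: infinite_finite_induct)
    (use ratfun_eval_of_nat[of 0 a] in \<open>simp_all add: ratfun_eval_add regular_at_sum\<close>)

text \<open>Each differentiation lowers the order of vanishing at \<open>a\<close> by at most one,
  and the regular factor absorbs everything else. For \<open>j < r\<close> the derivative therefore
  still vanishes at \<open>a\<close>.\<close>

lemma ratfun_deriv_funpow_high_order_zero:
  assumes "regular_at a g" "j \<le> r"
  shows "\<exists>h. regular_at a h \<and>
    (ratfun_deriv ^^ j) (Fract ([:- a, 1:] ^ r) 1 * g) = Fract ([:- a, 1:] ^ (r - j)) 1 * h"
  using assms(2)
proof (induction j)
  case 0
  then show ?case using assms(1) by auto
next
  case (Suc j)
  then obtain h where h: "regular_at a h"
    "(ratfun_deriv ^^ j) (Fract ([:- a, 1:] ^ r) 1 * g) = Fract ([:- a, 1:] ^ (r - j)) 1 * h"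
    by auto
  define t where "t = r - Suc j"
  have t: "r - j = Suc t" using Suc.prems by (simp add: t_def)
  let ?x = "[:- a, 1:]"
  have "ratfun_deriv (Fract (?x ^ Suc t) 1) = Fract (?x ^ t) 1 * Fract [:of_nat (Suc t):] 1"
    by (simp add: ratfun_deriv_Fract pderiv_power pderiv_pCons del: power_Suc of_nat_Suc)
  moreover have "Fract (?x ^ Suc t) 1 = Fract (?x ^ t) 1 * Fract ?x 1"
    by (simp add: mult.commute)
  ultimately have "ratfun_deriv (Fract (?x ^ Suc t) 1 * h) =
      Fract (?x ^ t) 1 * (Fract [:of_nat (Suc t):] 1 * h + Fract ?x 1 * ratfun_deriv h)"
    by (simp only: ratfun_deriv_mult algebra_simps)
  moreover have "regular_at a (Fract [:of_nat (Suc t):] 1 * h + Fract ?x 1 * ratfun_deriv h)"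
    by (intro regular_at_add regular_at_mult regular_at_poly regular_at_deriv h)
  ultimately show ?case using h(2) by (auto simp: t t_def)
qed

section \<open>The univariate formula\<close>

text \<open>The factors 1, ..., N of the factorial lie below a positive characteristic, so it
  divides none of them.\<close>

lemma of_nat_fact_neq_0:
  assumes "CHAR('a::field) = 0 \<or> N < CHAR('a)"
  shows "(of_nat (fact N) :: 'a) \<noteq> 0"
  using assms
proof (induction N)
  case (Suc N)
  have "\<not> CHAR('a) dvd Suc N" using Suc.prems by (auto dest: dvd_imp_le)
  then have "(of_nat (Suc N) :: 'a) \<noteq> 0" by (simp only: of_nat_eq_0_iff_char_dvd not_False_eq_True)
  with Suc show ?case by (simp only: fact_Suc of_nat_mult mult_eq_0_iff) auto
qed simp

text \<open>The product is a falling factorial. For \<open>k < m\<close> it contains the factor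
  \<open>k - k\<close>, so the truncated exponent \<open>k - m\<close> does no harm.\<close>

lemma pderiv_funpow_monom:
  "(pderiv ^^ m) (monom a k) = monom (of_nat (\<Prod>j<m. k - j) * a) (k - m)"
  by (induction m) (simp_all add: pderiv_monom mult_ac)

lemma pderiv_funpow_add: "(pderiv ^^ m) (p + q) = (pderiv ^^ m) p + (pderiv ^^ m) q"
  by (induction m) (simp_all add: pderiv_add)

lemma pderiv_funpow_degree_le:
  fixes p :: "'a::field poly"
  assumes "degree p \<le> N"
  shows "(pderiv ^^ N) p = [:of_nat (fact N) * coeff p N:]"
proof -
  have sum: "(pderiv ^^ N) (\<Sum>i\<le>M. f i) = (\<Sum>i\<le>M. (pderiv ^^ N) (f i))" for M and f :: "nat \<Rightarrow> 'a poly"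
    by (induction M) (simp_all add: pderiv_funpow_add)
  have zero: "(\<Prod>j<N. k - j) = 0" if "k < N" for k
    using that by (auto intro!: bexI[of _ k])
  have "(pderiv ^^ N) p = (\<Sum>i\<le>N. (pderiv ^^ N) (monom (coeff p i) i))"
    using poly_as_sum_of_monoms'[OF assms] sum by metis
  also have "\<dots> = (\<Sum>i\<le>N. if i = N then monom (of_nat (\<Prod>j<N. N - j) * coeff p N) 0 else 0)"
    by (intro sum.cong refl) (auto simp: pderiv_funpow_monom zero simp del: prod_zero_iff of_nat_prod)
  also have "(\<Prod>j<N. N - j) = fact N"
    by (simp add: fact_prod_rev lessThan_atLeast0)
  finally show ?thesis by (simp add: monom_0)
qed

text \<open>Since \<open>q\<close> is a unit modulo every power of x - a, \<open>A\<close> can be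
  taken as the expansion of p / q in powers of x - a, cut off before order \<open>r\<close>. It is
  built one coefficient at a time, so no division by factorials occurs.\<close>

lemma local_interpolation:
  fixes p q :: "'a::field poly"
  assumes "poly q a \<noteq> 0"
  shows "\<exists>A. (A = 0 \<or> degree A < r) \<and> [:- a, 1:] ^ r dvd p - A * q"
proof (induction r)
  case 0
  show ?case by (rule exI[of _ 0]) simp
next
  case (Suc r)
  let ?x = "[:- a, 1:]"
  obtain A B where A: "A = 0 \<or> degree A < r" and B: "p - A * q = ?x ^ r * B"
    using Suc.IH unfolding dvd_def by blast
  \<comment> \<open>The next coefficient is forced: the remainder \<open>B - smult b q\<close> must
    vanish at \<open>a\<close>.\<close>
  define b where "b = poly B a / poly q a"
  have "poly (B - smult b q) a = 0" using assms by (simp add: b_def)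
  then have "?x dvd B - smult b q" by (simp only: poly_eq_0_iff_dvd)
  then have "?x ^ r * ?x dvd ?x ^ r * (B - smult b q)" by (rule mult_dvd_mono[OF dvd_refl])
  moreover have "p - (A + smult b (?x ^ r)) * q = ?x ^ r * (B - smult b q)"
    using B by (simp add: algebra_simps)
  moreover have "degree (A + smult b (?x ^ r)) < Suc r"
    using A by (intro le_imp_less_Suc degree_add_le degree_smult_le[THEN order_trans])
      (auto simp: degree_linear_power)
  ultimately show ?case by (auto simp: mult.commute intro!: exI[of _ "A + smult b (?x ^ r)"])
qed

text \<open>This is the denominator in \<open>kappa\<close>: the monic polynomial with root multiset
  \<open>C\<close>, stripped of its factors x - a so that its reciprocal is regular at
  \<open>a\<close>.\<close>

abbreviation cofactor :: "'a::field multiset \<Rightarrow> 'a \<Rightarrow> 'a poly" where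
  "cofactor C a \<equiv> \<Prod>c\<in>set_mset C - {a}. [:- c, 1:] ^ count C c"

lemma poly_cofactor_neq_0: "poly (cofactor C a) a \<noteq> 0"
  by (auto simp: poly_prod)

lemma degree_cofactor:
  assumes "a \<in># C"
  shows "degree (cofactor C a) = size C - count C a"
proof -
  have "degree (cofactor C a) = (\<Sum>c\<in>set_mset C - {a}. count C c)"
    by (subst degree_prod_eq_sum_degree) (auto simp: degree_linear_power)
  also have "\<dots> = size C - count C a"
    using assms by (simp add: size_multiset_overloaded_eq sum_diff1_nat)
  finally show ?thesis .
qed

lemma lead_coeff_cofactor: "lead_coeff (cofactor C a) = 1"
  by (simp add: lead_coeff_prod lead_coeff_power del: prod_power_distrib)

text \<open>
  By the Leibniz rule the contribution of \<open>a\<close> is the residue at \<open>a\<close> of \<open>p\<close> divided by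
  the product of all \<open>x - c\<close>.
\<close>

lemma sum_kappa_eq_residue:
  fixes C :: "'a::field multiset"
  assumes char: "CHAR('a) = 0 \<or> count C a \<le> CHAR('a)" and a: "a \<in># C"
    and N: "N = count C a - 1"
  shows "(\<Sum>m<count C a. kappa C a m * poly ((pderiv ^^ m) p) a) =
    ratfun_eval ((ratfun_deriv ^^ N) (Fract p (cofactor C a))) a / of_nat (fact N)"
proof -
  let ?q = "cofactor C a"
  have cnt: "count C a = Suc N" using a N by simp
  have fact_ne: "(of_nat (fact m) :: 'a) \<noteq> 0" if "m \<le> N" for m
    using that char cnt by (intro of_nat_fact_neq_0) auto
  have reg: "regular_at a (Fract 1 ?q)"
    by (rule regular_at_Fract[OF poly_cofactor_neq_0])
  \<comment> \<open>Dividing the Leibniz coefficients by N! yields the factorials in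
    \<open>kappa\<close>; the bound on the characteristic makes this legitimate in the
    field.\<close>
  have binom: "of_nat (N choose m) / of_nat (fact N) =
      1 / (of_nat (fact m) * of_nat (fact (N - m)) :: 'a)" if "m \<le> N" for m
  proof -
    have "of_nat (fact N) = (of_nat (fact m) * of_nat (fact (N - m)) * of_nat (N choose m) :: 'a)"
      using binomial_fact_lemma[OF that] by (metis of_nat_mult)
    then show ?thesis
      using fact_ne[OF that] fact_ne[of "N - m"] fact_ne[of N] by (simp add: field_simps)
  qed
  have "Fract p ?q = Fract p 1 * Fract 1 ?q" by simp
  then have "ratfun_eval ((ratfun_deriv ^^ N) (Fract p ?q)) a =
    ratfun_eval (\<Sum>m\<le>N. of_nat (N choose m) *
      (Fract ((pderiv ^^ m) p) 1 * (ratfun_deriv ^^ (N - m)) (Fract 1 ?q))) a"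
    by (simp only: derivation_higher_mult[OF ratfun_deriv_add ratfun_deriv_mult]
        ratfun_deriv_funpow_poly)
  also have "\<dots> = (\<Sum>m\<le>N. of_nat (N choose m) *
      (poly ((pderiv ^^ m) p) a * ratfun_eval ((ratfun_deriv ^^ (N - m)) (Fract 1 ?q)) a))"
    by (simp add: ratfun_eval_sum ratfun_eval_mult regular_at_mult regular_at_of_nat
        regular_at_poly regular_at_deriv_funpow reg ratfun_eval_of_nat ratfun_eval_poly del: mult_fract)
  finally have "ratfun_eval ((ratfun_deriv ^^ N) (Fract p ?q)) a / of_nat (fact N) =
    (\<Sum>m\<le>N. of_nat (N choose m) / of_nat (fact N) *
      (poly ((pderiv ^^ m) p) a * ratfun_eval ((ratfun_deriv ^^ (N - m)) (Fract 1 ?q)) a))"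
    by (simp add: sum_divide_distrib)
  also have "\<dots> = (\<Sum>m\<le>N. kappa C a m * poly ((pderiv ^^ m) p) a)"
    by (intro sum.cong refl) (simp add: binom kappa_def cnt)
  finally show ?thesis by (simp add: cnt lessThan_Suc_atMost)
qed

text \<open>Dividing the congruence by the cofactor writes p / cofactor as \<open>A\<close> plus a
  regular multiple of (x - a)^(N+1), where N + 1 is the multiplicity of \<open>a\<close>. The N-th
  derivative of the second term vanishes at \<open>a\<close>. Since \<open>A\<close> has degree at
  most N, its own N-th derivative is the constant N! times its coefficient at N.\<close>

lemma sum_kappa_local:
  fixes C :: "'a::field multiset"
  assumes char: "CHAR('a) = 0 \<or> count C a \<le> CHAR('a)" and a: "a \<in># C"
    and A: "A = 0 \<or> degree A < count C a"
    and dvd: "[:- a, 1:] ^ count C a dvd p - A * cofactor C a"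
  shows "(\<Sum>m<count C a. kappa C a m * poly ((pderiv ^^ m) p) a) = coeff A (count C a - 1)"
proof -
  define N where "N = count C a - 1"
  have cnt: "count C a = Suc N" using a by (simp add: N_def)
  let ?q = "cofactor C a"
  let ?x = "[:- a, 1:]"
  obtain B where "p - A * ?q = ?x ^ Suc N * B"
    using dvd unfolding cnt by (rule dvdE)
  then have B: "p = A * ?q + ?x ^ Suc N * B"
    by (simp only: diff_eq_eq add.commute)
  have q0: "?q \<noteq> 0" using poly_cofactor_neq_0[of C a] by (metis poly_0)
  have eq: "Fract p ?q = Fract A 1 + Fract (?x ^ Suc N) 1 * Fract B ?q"
    using q0 by (simp add: B eq_fract algebra_simps del: power_Suc)
  obtain h where h: "regular_at a h"
    "(ratfun_deriv ^^ N) (Fract (?x ^ Suc N) 1 * Fract B ?q) = Fract (?x ^ (Suc N - N)) 1 * h"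
    using ratfun_deriv_funpow_high_order_zero[OF regular_at_Fract[OF poly_cofactor_neq_0],
        of N "Suc N" a B C, OF le_SucI[OF order_refl]]
    by blast
  have "ratfun_eval ((ratfun_deriv ^^ N) (Fract p ?q)) a =
      ratfun_eval (Fract ((pderiv ^^ N) A) 1 + Fract ?x 1 * h) a"
    unfolding eq ratfun_deriv_funpow_add h(2) ratfun_deriv_funpow_poly by simp
  also have "\<dots> = poly ((pderiv ^^ N) A) a"
    by (simp add: ratfun_eval_add ratfun_eval_mult regular_at_mult regular_at_poly h(1)
        ratfun_eval_poly)
  also have "(pderiv ^^ N) A = [:of_nat (fact N) * coeff A N:]"
    using A cnt by (intro pderiv_funpow_degree_le) auto
  finally have "ratfun_eval ((ratfun_deriv ^^ N) (Fract p ?q)) a = of_nat (fact N) * coeff A N"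
    by simp
  \<comment> \<open>Here N is one less than the multiplicity, so multiplicities equal to the
    characteristic are still allowed.\<close>
  moreover have "(of_nat (fact N) :: 'a) \<noteq> 0"
    using char cnt by (intro of_nat_fact_neq_0) auto
  ultimately show ?thesis
    unfolding sum_kappa_eq_residue[OF char a N_def] N_def[symmetric] by simp
qed

text \<open>The difference of the two sides has degree below \<open>size C\<close> but vanishes at
  each \<open>a\<close> to the order \<open>count C a\<close>. A nonzero polynomial cannot have that
  many roots, counted with multiplicity.\<close>

lemma partial_fractions:
  fixes C :: "'a::field multiset"
  assumes p: "degree p < size C"
    and A: "\<And>a. a \<in># C \<Longrightarrow> A a = 0 \<or> degree (A a) < count C a"
    and dvd: "\<And>a. a \<in># C \<Longrightarrow> [:- a, 1:] ^ count C a dvd p - A a * cofactor C a"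
  shows "p = (\<Sum>a\<in>set_mset C. A a * cofactor C a)"
proof (rule ccontr)
  define s where "s = p - (\<Sum>a\<in>set_mset C. A a * cofactor C a)"
  assume "\<not> ?thesis"
  then have s0: "s \<noteq> 0" by (simp add: s_def)
  have "degree (A a * cofactor C a) < size C" if a: "a \<in># C" for a
  proof (cases "A a = 0")
    case False
    with A[OF a] have "degree (A a) < count C a" by blast
    moreover have "count C a \<le> size C" by (rule count_le_size)
    ultimately show ?thesis
      using degree_mult_le[of "A a" "cofactor C a"] degree_cofactor[OF a] by linarith
  qed (use p in simp)
  then have "degree (\<Sum>a\<in>set_mset C. A a * cofactor C a) < size C"
    using p by (intro degree_sum_less) auto
  with p have deg: "degree s < size C"
    unfolding s_def by (rule degree_diff_less)
  have "count C a \<le> count (proots s) a" for a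
  proof (cases "a \<in># C")
    case a: True
    let ?x = "[:- a, 1:] ^ count C a"
    \<comment> \<open>Every cofactor at another point \<open>b\<close> still contains the full power
      of x - a, so modulo this power only the summand at \<open>a\<close> matters.\<close>
    have "?x dvd A b * cofactor C b" if "b \<in> set_mset C - {a}" for b
      using that a by (intro dvd_mult dvd_prodI) auto
    then have "?x dvd (p - A a * cofactor C a) - (\<Sum>b\<in>set_mset C - {a}. A b * cofactor C b)"
      by (intro dvd_diff dvd[OF a] dvd_sum)
    also have "\<dots> = s"
      using a by (simp add: s_def sum.remove[of _ a])
    finally show ?thesis using s0 by (simp add: order_divides)
  qed (simp add: not_in_iff)
  then have "C \<subseteq># proots s" by (rule mset_subset_eqI)
  then have "size C \<le> size (proots s)" by (rule size_mset_mono)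
  with size_proots_le[of s] deg show False by linarith
qed

text \<open>Coefficients of x^d are compared in the partial fraction identity. The cofactor at
  \<open>a\<close> is monic of degree \<open>d - (count C a - 1)\<close>, so each summand
  contributes exactly the coefficient of \<open>A a\<close> at \<open>count C a - 1\<close>, the
  value found in \<open>sum_kappa_local\<close>.\<close>

theorem sum_kappa_eq_coeff:
  fixes C :: "'a::field multiset"
  assumes char: "CHAR('a) = 0 \<or> (\<forall>c. count C c \<le> CHAR('a))"
    and size: "size C = d + 1" and deg: "degree p \<le> d"
  shows "(\<Sum>a\<in>set_mset C. \<Sum>m<count C a. kappa C a m * poly ((pderiv ^^ m) p) a) = coeff p d"
proof -
  \<comment> \<open>The choice covers all field elements; outside \<open>C\<close> the multiplicity
    is 0, which forces \<open>A a = 0\<close>.\<close>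
  have "\<exists>A. \<forall>a. (A a = 0 \<or> degree (A a) < count C a) \<and>
      [:- a, 1:] ^ count C a dvd p - A a * cofactor C a"
    by (intro choice allI local_interpolation poly_cofactor_neq_0)
  then obtain A where A: "\<And>a. A a = 0 \<or> degree (A a) < count C a"
    and dvd: "\<And>a. [:- a, 1:] ^ count C a dvd p - A a * cofactor C a"
    by blast
  have top: "coeff (A a * cofactor C a) d = coeff (A a) (count C a - 1)" if a: "a \<in># C" for a
  proof -
    have cnt: "0 < count C a" "count C a \<le> size C"
      using a by (auto simp: count_le_size)
    have d: "d = (count C a - 1) + degree (cofactor C a)"
      using cnt size by (simp add: degree_cofactor[OF a])
    have "degree (A a) \<le> count C a - 1" using A[of a] by auto
    then consider "degree (A a) = count C a - 1" | "degree (A a) < count C a - 1"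
      by linarith
    then show ?thesis
    proof cases
      case 1
      then show ?thesis
        using coeff_mult_degree_sum[of "A a" "cofactor C a"] lead_coeff_cofactor[of C a] d by simp
    next
      case 2
      then have "degree (A a * cofactor C a) < d"
        using degree_mult_le[of "A a" "cofactor C a"] d by linarith
      with 2 show ?thesis by (simp add: coeff_eq_0)
    qed
  qed
  have "(\<Sum>a\<in>set_mset C. \<Sum>m<count C a. kappa C a m * poly ((pderiv ^^ m) p) a) =
      (\<Sum>a\<in>set_mset C. coeff (A a) (count C a - 1))"
    using char by (intro sum.cong refl sum_kappa_local A dvd) auto
  also have "\<dots> = coeff (\<Sum>a\<in>set_mset C. A a * cofactor C a) d"
    by (simp add: coeff_sum top)
  also have "(\<Sum>a\<in>set_mset C. A a * cofactor C a) = p"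
    using partial_fractions[of p C A] A dvd deg size by simp
  finally show ?thesis .
qed

section \<open>Mixed partial derivatives of multivariate polynomials\<close>

lemma mpolynomial_as_sum:
  "F = (\<Sum>k\<in>Poly_Mapping.keys F. Poly_Mapping.single k (Poly_Mapping.lookup F k))"
  by (rule poly_mapping_eqI)
    (auto simp: lookup_sum lookup_single when_def not_in_keys_iff_lookup_eq_zero)

text \<open>Cancellation can remove keys from \<open>F + G\<close>. As \<open>h k 0 = 0\<close>, all
  three sums may be extended to the union of the two key sets and then added termwise.\<close>

lemma sum_keys_add:
  fixes F G :: "'b \<Rightarrow>\<^sub>0 'a::comm_monoid_add" and h :: "'b \<Rightarrow> 'a \<Rightarrow> 'c::comm_monoid_add"
  assumes h0: "\<And>k. h k 0 = 0" and hadd: "\<And>k x y. h k (x + y) = h k x + h k y"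
  shows "(\<Sum>k\<in>Poly_Mapping.keys (F + G). h k (Poly_Mapping.lookup (F + G) k)) =
    (\<Sum>k\<in>Poly_Mapping.keys F. h k (Poly_Mapping.lookup F k)) +
    (\<Sum>k\<in>Poly_Mapping.keys G. h k (Poly_Mapping.lookup G k))"
proof -
  let ?S = "Poly_Mapping.keys F \<union> Poly_Mapping.keys G"
  have ext: "(\<Sum>k\<in>Poly_Mapping.keys H. h k (Poly_Mapping.lookup H k)) =
      (\<Sum>k\<in>?S. h k (Poly_Mapping.lookup H k))" if "Poly_Mapping.keys H \<subseteq> ?S" for H
    using that by (intro sum.mono_neutral_left) (auto simp: h0 not_in_keys_iff_lookup_eq_zero)
  show ?thesis
    by (subst (1 2 3) ext) (use keys_add[of F G] in \<open>auto simp: lookup_add hadd sum.distrib\<close>)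
qed

lemma mpoly_eval_add: "mpoly_eval x (F + G) = mpoly_eval x F + mpoly_eval x G"
  unfolding mpoly_eval_def by (rule sum_keys_add) (simp_all add: algebra_simps)

lemma mpoly_eval_single:
  "mpoly_eval x (Poly_Mapping.single k a) =
    a * (\<Prod>i\<in>Poly_Mapping.keys k. x i ^ Poly_Mapping.lookup k i)"
  by (simp add: mpoly_eval_def)

lemma mpoly_eval_sum: "mpoly_eval x (sum f A) = (\<Sum>k\<in>A. mpoly_eval x (f k))"
  by (induction A rule: infinite_finite_induct)
    (simp_all add: mpoly_eval_add, simp_all add: mpoly_eval_def)

lemma mpoly_pderiv_add: "mpoly_pderiv i (F + G) = mpoly_pderiv i F + mpoly_pderiv i G"
  unfolding mpoly_pderiv_def by (rule sum_keys_add) (simp_all add: single_add algebra_simps)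

lemma mpoly_pderiv_single:
  "mpoly_pderiv i (Poly_Mapping.single k a) =
    Poly_Mapping.single (k - Poly_Mapping.single i 1) (of_nat (Poly_Mapping.lookup k i) * a)"
  by (simp add: mpoly_pderiv_def)

lemma mpoly_pderiv_funpow_add:
  "(mpoly_pderiv i ^^ m) (F + G) = (mpoly_pderiv i ^^ m) F + (mpoly_pderiv i ^^ m) G"
  by (induction m) (simp_all add: mpoly_pderiv_add)

text \<open>The coefficient is the same falling factorial as in \<open>pderiv_funpow_monom\<close>,
  so that multivariate and univariate derivatives can be matched factor by factor.\<close>

lemma mpoly_pderiv_funpow_single:
  "(mpoly_pderiv i ^^ m) (Poly_Mapping.single k a) =
    Poly_Mapping.single (k - Poly_Mapping.single i m)
      (of_nat (\<Prod>j<m. Poly_Mapping.lookup k i - j) * a)"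
proof (induction m)
  case (Suc m)
  have "k - Poly_Mapping.single i m - Poly_Mapping.single i 1 = k - Poly_Mapping.single i (Suc m)"
    by (rule poly_mapping_eqI) (simp add: lookup_minus lookup_single when_def)
  with Suc show ?case
    by (simp add: mpoly_pderiv_single lookup_minus mult_ac)
qed simp

lemma mixed_pderiv_add: "mixed_pderiv n m (F + G) = mixed_pderiv n m F + mixed_pderiv n m G"
proof -
  have "foldr (\<lambda>i. mpoly_pderiv i ^^ m i) is (F + G) =
      foldr (\<lambda>i. mpoly_pderiv i ^^ m i) is F + foldr (\<lambda>i. mpoly_pderiv i ^^ m i) is G" for "is"
    by (induction "is") (simp_all add: mpoly_pderiv_funpow_add)
  then show ?thesis by (simp add: mixed_pderiv_def)
qed

lemma mixed_pderiv_sum: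
  fixes f :: "'b \<Rightarrow> 'a::comm_ring_1 mpolynomial"
  shows "mixed_pderiv n m (sum f A) = (\<Sum>k\<in>A. mixed_pderiv n m (f k))"
proof -
  have "mixed_pderiv n m (0 :: 'a mpolynomial) = 0"
    using mixed_pderiv_add[of n m "0 :: 'a mpolynomial" 0] by simp
  then show ?thesis
    by (induction A rule: infinite_finite_induct) (simp_all add: mixed_pderiv_add)
qed

lemma mixed_pderiv_single:
  "mixed_pderiv n m (Poly_Mapping.single k a) =
    Poly_Mapping.single (k - exponent_vector n m)
      ((\<Prod>i\<in>{1..n}. of_nat (\<Prod>j<m i. Poly_Mapping.lookup k i - j)) * a)"
proof -
  \<comment> \<open>The induction needs an arbitrary list of indices. Distinctness ensures that the
    derivatives taken earlier leave the exponent of the current variable unchanged.\<close>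
  have "foldr (\<lambda>i. mpoly_pderiv i ^^ m i) is (Poly_Mapping.single k a) =
      Poly_Mapping.single (k - (\<Sum>i\<in>set is. Poly_Mapping.single i (m i)))
        ((\<Prod>i\<in>set is. of_nat (\<Prod>j<m i. Poly_Mapping.lookup k i - j)) * a)"
    if "distinct is" for "is"
    using that
  proof (induction "is")
    case (Cons i "is")
    define S where "S = (\<Sum>i\<in>set is. Poly_Mapping.single i (m i))"
    have S: "Poly_Mapping.lookup S i = 0"
      using Cons.prems by (auto simp: S_def lookup_sum lookup_single when_def intro!: sum.neutral)
    have "k - S - Poly_Mapping.single i (m i) = k - (Poly_Mapping.single i (m i) + S)"
      by (rule poly_mapping_eqI) (simp add: lookup_minus lookup_add)
    with Cons S show ?case
      by (simp add: mpoly_pderiv_funpow_single lookup_minus mult_ac flip: S_def)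
  qed simp
  from this[of "[1..<Suc n]"] show ?thesis
    by (simp add: mixed_pderiv_def exponent_vector_def atLeastLessThanSuc_atLeastAtMost
        del: upt_Suc)
qed

lemma lookup_exponent_vector:
  "Poly_Mapping.lookup (exponent_vector n d) i = (if i \<in> {1..n} then d i else 0)"
  by (simp add: exponent_vector_def lookup_sum lookup_single when_def)

lemma mpoly_eval_mixed_pderiv_single:
  fixes a :: "'a::field"
  assumes "Poly_Mapping.keys k \<subseteq> {1..n}"
  shows "mpoly_eval x (mixed_pderiv n m (Poly_Mapping.single k a)) =
    a * (\<Prod>i\<in>{1..n}. poly ((pderiv ^^ m i) (monom 1 (Poly_Mapping.lookup k i))) (x i))"
proof -
  let ?k = "k - exponent_vector n m"
  have "Poly_Mapping.keys ?k \<subseteq> {1..n}"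
    using assms by (auto simp: in_keys_iff lookup_minus)
  \<comment> \<open>Variables absent from the monomial have exponent 0 and contribute the factor
    1.\<close>
  then have "(\<Prod>i\<in>Poly_Mapping.keys ?k. x i ^ Poly_Mapping.lookup ?k i) =
      (\<Prod>i\<in>{1..n}. x i ^ Poly_Mapping.lookup ?k i)"
    by (intro prod.mono_neutral_left) (auto simp: in_keys_iff)
  also have "\<dots> = (\<Prod>i\<in>{1..n}. x i ^ (Poly_Mapping.lookup k i - m i))"
    by (intro prod.cong refl) (simp add: lookup_minus lookup_exponent_vector)
  finally show ?thesis
    by (simp add: mixed_pderiv_single mpoly_eval_single pderiv_funpow_monom poly_monom
        prod.distrib mult_ac del: of_nat_prod)
qed

lemma mpoly_eval_mixed_pderiv:
  fixes F :: "'a::field mpolynomial"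
  assumes "F \<in> mpolynomials_in {1..n}"
  shows "mpoly_eval x (mixed_pderiv n m F) =
    (\<Sum>k\<in>Poly_Mapping.keys F. Poly_Mapping.lookup F k *
      (\<Prod>i\<in>{1..n}. poly ((pderiv ^^ m i) (monom 1 (Poly_Mapping.lookup k i))) (x i)))"
proof -
  have "mpoly_eval x (mixed_pderiv n m F) = (\<Sum>k\<in>Poly_Mapping.keys F.
      mpoly_eval x (mixed_pderiv n m (Poly_Mapping.single k (Poly_Mapping.lookup F k))))"
    by (subst mpolynomial_as_sum[of F]) (simp only: mixed_pderiv_sum mpoly_eval_sum)
  also have "\<dots> = (\<Sum>k\<in>Poly_Mapping.keys F. Poly_Mapping.lookup F k *
      (\<Prod>i\<in>{1..n}. poly ((pderiv ^^ m i) (monom 1 (Poly_Mapping.lookup k i))) (x i)))"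
    using assms
    by (intro sum.cong refl mpoly_eval_mixed_pderiv_single) (simp add: mpolynomials_in_def)
  finally show ?thesis .
qed

section \<open>The coefficient formula\<close>

theorem theorem2:
  fixes F :: "'a::field mpolynomial"
    and n :: nat
    and d :: "nat \<Rightarrow> nat"
    and C :: "nat \<Rightarrow> 'a multiset"
  assumes "F \<in> mpolynomials_in {1..n}"
    and "no_monomial_majorizes n d F"
    and "\<And>i. i \<in> {1..n} \<Longrightarrow> size (C i) = d i + 1"
    and "CHAR('a) = 0 \<or> (\<forall>i\<in>{1..n}. \<forall>c. CHAR('a) \<ge> count (C i) c)"
  shows "Poly_Mapping.lookup F (exponent_vector n d) =
           (\<Sum>c\<in>Pi\<^sub>E {1..n} (\<lambda>i. set_mset (C i)).
             \<Sum>m\<in>Pi\<^sub>E {1..n} (\<lambda>i. {..<count (C i) (c i)}).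
               (\<Prod>i\<in>{1..n}. kappa (C i) (c i) (m i)) * mpoly_eval c (mixed_pderiv n m F))
         \<and>
         (Poly_Mapping.lookup F (exponent_vector n d) \<noteq> 0 \<longrightarrow>
           (\<exists>c m. (\<forall>i\<in>{1..n}. c i \<in># C i \<and> m i < count (C i) (c i)) \<and>
                  mpoly_eval c (mixed_pderiv n m F) \<noteq> 0))"
proof -
  let ?I = "{1..n}" and ?K = "Poly_Mapping.keys F" and ?M = "exponent_vector n d"
  let ?c = "Pi\<^sub>E ?I (\<lambda>i. set_mset (C i))"
  let ?m = "\<lambda>c. Pi\<^sub>E ?I (\<lambda>i. {..<count (C i) (c i)})"
  define t where "t k i a m = kappa (C i) a m * poly ((pderiv ^^ m) (monom 1 (Poly_Mapping.lookup k i))) a"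
    for k i a m
  \<comment> \<open>This is the univariate functional for \<open>C i\<close>, applied to the power
    of the i-th variable in the monomial \<open>k\<close>.\<close>
  define L where "L k i = (\<Sum>a\<in>set_mset (C i). \<Sum>m<count (C i) a. t k i a m)" for k i
  have L: "L k i = (if Poly_Mapping.lookup k i = d i then 1 else 0)"
    if "i \<in> ?I" "Poly_Mapping.lookup k i \<le> d i" for k i
    unfolding L_def t_def using that assms(3)[OF that(1)] assms(4)
    by (subst sum_kappa_eq_coeff[where d = "d i"]) (auto simp: degree_monom_eq)
  \<comment> \<open>\<open>L\<close> has been evaluated only for exponents up to \<open>d i\<close>.
    That suffices: a monomial other than M has an exponent below some \<open>d i\<close>, and that
    single zero factor kills the product however large the other exponents are.\<close>
  have prod_L: "(\<Prod>i\<in>?I. L k i) = (if k = ?M then 1 else 0)" if k: "k \<in> ?K" for k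
  proof (cases "\<forall>i\<in>?I. Poly_Mapping.lookup k i = d i")
    case True
    have "i \<notin> Poly_Mapping.keys k" if "i \<notin> ?I" for i
      using assms(1) k that unfolding mpolynomials_in_def by blast
    with True have "k = ?M"
      by (intro poly_mapping_eqI) (auto simp: lookup_exponent_vector in_keys_iff)
    with True show ?thesis by (simp add: L)
  next
    case False
    then obtain i where i: "i \<in> ?I" "Poly_Mapping.lookup k i < d i"
      using assms(2) k by (auto simp: no_monomial_majorizes_def)
    then have "(\<Prod>i\<in>?I. L k i) = 0"
      by (intro prod_zero) (auto simp: L intro!: bexI[of _ i])
    moreover have "k \<noteq> ?M" using i by (auto simp: lookup_exponent_vector)
    ultimately show ?thesis by simp
  qed
  have "(\<Sum>c\<in>?c. \<Sum>m\<in>?m c. (\<Prod>i\<in>?I. kappa (C i) (c i) (m i)) * mpoly_eval c (mixed_pderiv n m F)) =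
      (\<Sum>c\<in>?c. \<Sum>m\<in>?m c. \<Sum>k\<in>?K. Poly_Mapping.lookup F k * (\<Prod>i\<in>?I. t k i (c i) (m i)))"
    by (simp add: mpoly_eval_mixed_pderiv[OF assms(1)] t_def prod.distrib sum_distrib_left mult_ac)
  also have "\<dots> = (\<Sum>c\<in>?c. \<Sum>k\<in>?K. \<Sum>m\<in>?m c. Poly_Mapping.lookup F k * (\<Prod>i\<in>?I. t k i (c i) (m i)))"
    by (intro sum.cong refl sum.swap)
  also have "\<dots> = (\<Sum>k\<in>?K. \<Sum>c\<in>?c. \<Sum>m\<in>?m c. Poly_Mapping.lookup F k * (\<Prod>i\<in>?I. t k i (c i) (m i)))"
    by (rule sum.swap)
  also have "\<dots> = (\<Sum>k\<in>?K. Poly_Mapping.lookup F k * (\<Sum>c\<in>?c. \<Sum>m\<in>?m c. \<Prod>i\<in>?I. t k i (c i) (m i)))"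
    by (simp add: sum_distrib_left)
  \<comment> \<open>Distributivity is applied twice, first for the sums over \<open>m\<close>, whose
    ranges depend on \<open>c\<close>, and then for the sums over \<open>c\<close>.\<close>
  also have "\<dots> = (\<Sum>k\<in>?K. Poly_Mapping.lookup F k * (\<Prod>i\<in>?I. L k i))"
    by (simp add: L_def prod_sum_PiE)
  also have "\<dots> = (\<Sum>k\<in>?K. if k = ?M then Poly_Mapping.lookup F k else 0)"
    by (intro sum.cong refl) (simp only: prod_L, simp)
  \<comment> \<open>If M is not a key of \<open>F\<close>, the sum has no surviving term and the
    coefficient is 0 as well.\<close>
  also have "\<dots> = Poly_Mapping.lookup F ?M"
    by (simp add: in_keys_iff)
  finally have main: "Poly_Mapping.lookup F ?M = (\<Sum>c\<in>?c. \<Sum>m\<in>?m c.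
      (\<Prod>i\<in>?I. kappa (C i) (c i) (m i)) * mpoly_eval c (mixed_pderiv n m F))"
    by (rule sym)
  moreover have "\<exists>c m. (\<forall>i\<in>?I. c i \<in># C i \<and> m i < count (C i) (c i)) \<and>
      mpoly_eval c (mixed_pderiv n m F) \<noteq> 0" if "Poly_Mapping.lookup F ?M \<noteq> 0"
  proof -
    from that obtain c where c: "c \<in> ?c" "(\<Sum>m\<in>?m c.
        (\<Prod>i\<in>?I. kappa (C i) (c i) (m i)) * mpoly_eval c (mixed_pderiv n m F)) \<noteq> 0"
      unfolding main by (rule sum.not_neutral_contains_not_neutral)
    from c(2) obtain m where m: "m \<in> ?m c"
      "(\<Prod>i\<in>?I. kappa (C i) (c i) (m i)) * mpoly_eval c (mixed_pderiv n m F) \<noteq> 0"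
      by (rule sum.not_neutral_contains_not_neutral)
    from m(2) have "mpoly_eval c (mixed_pderiv n m F) \<noteq> 0" by simp
    with c(1) m(1) show ?thesis by (blast dest: PiE_mem)
  qed
  ultimately show ?thesis by blast
qed

end
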